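(* Let $n\ge3$ and $d\ge2$. If an automorphism $T\in\mathbb{T}_n^d$ fixes all corners of the cube $n^d$ and fixes every point of some edge $e$, then $T$ is the identity.
   Context: Let $[n]=\{0,\dots,n-1\}$; the cube $n^d$ is $[n]^d$. A set of $n$ distinct points is a line if it can be ordered $(q^1,\dots,q^n)$ such that in each coordinate the sequence of values is strictly increasing, strictly decreasing or constant, with at least one coordinate non-constant; the dimension of a line is the number of its non-constant coordinates. $\mathbb{T}_n^d$ is the group of permutations of $[n]^d$ mapping lines onto lines. A corner is a point with all coordinates in $\{0,n-1\}$. An edge is a line of dimension $1$ containing two corners. *)

theory Defs
  imports "HOL-Combinatorics.Permutations" "HOL-Library.FuncSet"
begin

(* Points of [n]^d are extensional functions: p i is the i-th coordinate for i < d,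
   and p i = undefined for i >= d. *)
definition cube :: "nat \<Rightarrow> nat \<Rightarrow> (nat \<Rightarrow> nat) set" where
  "cube n d = {..<d} \<rightarrow>\<^sub>E {..<n}"

definition nonconst_coords :: "nat \<Rightarrow> (nat \<Rightarrow> nat) set \<Rightarrow> nat set" where
  "nonconst_coords d L = {i. i < d \<and> (\<exists>p\<in>L. \<exists>q\<in>L. p i \<noteq> q i)}"

definition is_line :: "nat \<Rightarrow> nat \<Rightarrow> (nat \<Rightarrow> nat) set \<Rightarrow> bool" where
  "is_line n d L \<longleftrightarrow>
     L \<subseteq> cube n d \<and>
     (\<exists>q. inj_on q {..<n} \<and> L = q ` {..<n} \<and>
          (\<forall>i<d. strict_mono_on {..<n} (\<lambda>k. q k i) \<or>
                 strict_antimono_on {..<n} (\<lambda>k. q k i) \<or>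
                 (\<exists>c. \<forall>k<n. q k i = c))) \<and>
     nonconst_coords d L \<noteq> {}"

definition line_dim :: "nat \<Rightarrow> (nat \<Rightarrow> nat) set \<Rightarrow> nat" where
  "line_dim d L = card (nonconst_coords d L)"

(* The carrier of the group; as the cube is finite and T is a permutation of it, T also
   permutes the finite set of lines, so no separate condition on the inverse of T is needed. *)
definition line_automorphisms ::
    "nat \<Rightarrow> nat \<Rightarrow> ((nat \<Rightarrow> nat) \<Rightarrow> (nat \<Rightarrow> nat)) set" where
  "line_automorphisms n d =
     {T. T permutes cube n d \<and> (\<forall>L. is_line n d L \<longrightarrow> is_line n d (T ` L))}"

definition corners :: "nat \<Rightarrow> nat \<Rightarrow> (nat \<Rightarrow> nat) set" where
  "corners n d = {p \<in> cube n d. \<forall>i<d. p i \<in> {0, n - 1}}"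

definition is_edge :: "nat \<Rightarrow> nat \<Rightarrow> (nat \<Rightarrow> nat) set \<Rightarrow> bool" where
  "is_edge n d e \<longleftrightarrow>
     is_line n d e \<and> line_dim d e = 1 \<and>
     (\<exists>a b. a \<in> corners n d \<and> b \<in> corners n d \<and> a \<noteq> b \<and> a \<in> e \<and> b \<in> e)"

end

theory Submission
  imports Defs
begin

text \<open>
  Two distinct points lie on at most one line, so a line through two fixed points is mapped onto
  itself, and the common point of two such lines is fixed. If an edge is fixed pointwise, then so
  is the opposite edge of any two-dimensional face containing it: the latter is preserved as a set,
  and a non-corner point of the first edge is collinear with no non-corner point of the second
  other than the one directly opposite. Passing through the diagonal of the face one also reaches
  the perpendicular edges, so all edges are fixed pointwise. Finally, by induction on the number of
  coordinates not in \<open>{0, n - 1}\<close>: a point with at least two such coordinates is the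
  intersection of two axis-parallel lines whose end points are already fixed.
\<close>

section \<open>Strictly monotone self-maps of {0, ..., n - 1}\<close>

lemma strict_mono_on_lessThan_ge:
  fixes f :: "nat \<Rightarrow> nat"
  assumes "strict_mono_on {..<n} f" and "k < n"
  shows "k \<le> f k"
  using assms(2)
proof (induction k)
  case (Suc k)
  have "f k < f (Suc k)"
    using Suc.prems by (intro strict_mono_onD[OF assms(1)]) auto
  with Suc show ?case by simp
qed simp

lemma strict_mono_on_lessThan_endo:
  fixes f :: "nat \<Rightarrow> nat"
  assumes mono: "strict_mono_on {..<n} f" and bound: "\<And>k. k < n \<Longrightarrow> f k < n" and k: "k < n"
  shows "f k = k"
proof (rule antisym)
  \<comment> \<open>Reflecting both argument and value preserves strict increase, so the lower bound
    for the reflected map is the missing upper bound for \<open>f\<close>.\<close>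
  have "strict_mono_on {..<n} (\<lambda>k. n - 1 - f (n - 1 - k))"
  proof (rule strict_mono_onI)
    fix r s assume "r \<in> {..<n}" "s \<in> {..<n}" "r < s"
    then have "f (n - 1 - s) < f (n - 1 - r)"
      by (intro strict_mono_onD[OF mono]) auto
    moreover have "f (n - 1 - r) < n"
      using \<open>r \<in> {..<n}\<close> by (intro bound) auto
    ultimately show "n - 1 - f (n - 1 - r) < n - 1 - f (n - 1 - s)" by linarith
  qed
  then have "n - 1 - k \<le> n - 1 - f (n - 1 - (n - 1 - k))"
    by (rule strict_mono_on_lessThan_ge) (use k in auto)
  then show "f k \<le> k"
    using k bound[OF k] by simp
  show "k \<le> f k"
    using mono k by (rule strict_mono_on_lessThan_ge)
qed

lemma strict_antimono_on_lessThan_endo: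
  fixes f :: "nat \<Rightarrow> nat"
  assumes anti: "strict_antimono_on {..<n} f" and bound: "\<And>k. k < n \<Longrightarrow> f k < n" and k: "k < n"
  shows "f k = n - 1 - k"
proof -
  have "n - 1 - f k = k"
  proof (rule strict_mono_on_lessThan_endo[where f = "\<lambda>k. n - 1 - f k"])
    show "strict_mono_on {..<n} (\<lambda>k. n - 1 - f k)"
    proof (rule strict_mono_onI)
      fix r s assume "r \<in> {..<n}" "s \<in> {..<n}" "r < s"
      with anti have "f s < f r" by (auto simp: monotone_on_def)
      moreover have "f r < n" using \<open>r \<in> {..<n}\<close> by (intro bound) auto
      ultimately show "n - 1 - f r < n - 1 - f s" by linarith
    qed
  qed (use k in auto)
  with bound[OF k] show ?thesis by linarith
qed

section \<open>Coordinates along a line\<close>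

definition coord_rule :: "nat \<Rightarrow> (nat \<Rightarrow> nat) \<Rightarrow> bool" where
  "coord_rule n g \<longleftrightarrow>
     (\<forall>k<n. g k = k) \<or> (\<forall>k<n. g k = n - 1 - k) \<or> (\<exists>c. \<forall>k<n. g k = c)"

lemma coord_rule_reverse:
  assumes "coord_rule n g"
  shows "coord_rule n (\<lambda>k. g (n - 1 - k))"
proof -
  consider "\<forall>k<n. g k = k" | "\<forall>k<n. g k = n - 1 - k" | c where "\<forall>k<n. g k = c"
    using assms by (auto simp: coord_rule_def)
  then show ?thesis
    by cases (auto simp: coord_rule_def)
qed

text \<open>Identity and reversal agree only where 2k = n - 1, and a constant meets either of them
  at most once, so two different rules never agree at two arguments.\<close>

lemma coord_rule_unique:
  assumes "coord_rule n g" "coord_rule n h"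
    and "a < n" "b < n" "a \<noteq> b" "g a = h a" "g b = h b" "k < n"
  shows "g k = h k"
proof -
  \<comment> \<open>The unknown constant is eliminated in favour of \<open>f a = f b\<close>, so
    that comparing two rules becomes linear arithmetic.\<close>
  have cases: "f a = a \<and> f b = b \<and> f k = k
      \<or> f a = n - 1 - a \<and> f b = n - 1 - b \<and> f k = n - 1 - k
      \<or> f a = f b \<and> f k = f a" if "coord_rule n f" for f
    using that assms(3,4,8) unfolding coord_rule_def by (elim disjE exE) simp_all
  show ?thesis
    using cases[OF assms(1)] cases[OF assms(2)] assms(3-)
    by (elim disjE conjE) linarith+
qed

text \<open>A coordinate in which two points of the line differ is the identity or the reversal.
  Reversing the enumeration in the second case indexes each point by its own \<open>i\<close>-th
  coordinate, which makes lines through the same two points comparable.\<close>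

lemma line_param:
  assumes "is_line n d L" and "p \<in> L" "q \<in> L" "i < d" "p i \<noteq> q i"
  obtains f where "L = f ` {..<n}" "\<And>k. k < n \<Longrightarrow> f k \<in> cube n d" "\<And>k. k < n \<Longrightarrow> f k i = k"
    "\<And>j. j < d \<Longrightarrow> coord_rule n (\<lambda>k. f k j)"
proof -
  obtain g where g: "L \<subseteq> cube n d" "L = g ` {..<n}"
    and dir: "\<forall>j<d. strict_mono_on {..<n} (\<lambda>k. g k j) \<or>
                 strict_antimono_on {..<n} (\<lambda>k. g k j) \<or>
                 (\<exists>c. \<forall>k<n. g k j = c)"
    using assms(1) by (auto simp: is_line_def)
  have cube: "g k \<in> cube n d" if "k < n" for k
    using g that by auto
  have bound: "g k j < n" if "k < n" "j < d" for k j
    using cube[OF that(1)] that(2) by (auto simp: cube_def)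
  \<comment> \<open>Coordinates stay below \<open>n\<close>, so strict monotonicity leaves only the
    identity and the reversal.\<close>
  have rule: "coord_rule n (\<lambda>k. g k j)" if j: "j < d" for j
  proof -
    consider "strict_mono_on {..<n} (\<lambda>k. g k j)" | "strict_antimono_on {..<n} (\<lambda>k. g k j)"
      | "\<exists>c. \<forall>k<n. g k j = c" using dir j by blast
    then show ?thesis
    proof cases
      case 1
      then have "\<forall>k<n. g k j = k"
        using strict_mono_on_lessThan_endo[OF 1] bound j by blast
      then show ?thesis by (simp add: coord_rule_def)
    next
      case 2
      then have "\<forall>k<n. g k j = n - 1 - k"
        using strict_antimono_on_lessThan_endo[OF 2] bound j by blast
      then show ?thesis by (simp add: coord_rule_def)
    qed (simp add: coord_rule_def)
  qed
  consider "\<forall>k<n. g k i = k" | "\<forall>k<n. g k i = n - 1 - k" | c where "\<forall>k<n. g k i = c"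
    using rule[OF \<open>i < d\<close>] by (auto simp: coord_rule_def)
  then show ?thesis
  proof cases
    case 1
    then show ?thesis using g cube rule by (intro that[of g]) auto
  next
    case 2
    have "L = (\<lambda>k. g (n - 1 - k)) ` {..<n}"
    proof -
      have "g k \<in> (\<lambda>k. g (n - 1 - k)) ` {..<n}" if "k < n" for k
        using that by (intro image_eqI[of _ _ "n - 1 - k"]) auto
      then show ?thesis unfolding g by auto
    qed
    then show ?thesis
      using 2 cube coord_rule_reverse[OF rule] by (intro that[of "\<lambda>k. g (n - 1 - k)"]) auto
  next
    case 3
    then show ?thesis using assms g by auto
  qed
qed

lemma cube_eqI:
  assumes "p \<in> cube n d" "q \<in> cube n d" "\<And>j. j < d \<Longrightarrow> p j = q j"
  shows "p = q"
  using assms unfolding cube_def by (intro PiE_ext) auto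

text \<open>Choose \<open>i\<close> with \<open>p i \<noteq> q i\<close> and index both lines by
  this coordinate. The two enumerations then agree at the parameters \<open>p i\<close> and
  \<open>q i\<close>, hence everywhere by \<open>coord_rule_unique\<close> in each
  coordinate.\<close>

lemma line_unique:
  assumes "is_line n d L" "is_line n d M" "p \<in> L" "q \<in> L" "p \<in> M" "q \<in> M" "p \<noteq> q"
  shows "L = M"
proof -
  have pq: "p \<in> cube n d" "q \<in> cube n d"
    using assms by (auto simp: is_line_def)
  then obtain i where i: "i < d" "p i \<noteq> q i"
    using cube_eqI assms(7) by blast
  obtain f where f: "L = f ` {..<n}" "\<And>k. k < n \<Longrightarrow> f k \<in> cube n d" "\<And>k. k < n \<Longrightarrow> f k i = k"
    "\<And>j. j < d \<Longrightarrow> coord_rule n (\<lambda>k. f k j)"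
    using line_param[OF assms(1,3,4) i] by metis
  obtain g where g: "M = g ` {..<n}" "\<And>k. k < n \<Longrightarrow> g k \<in> cube n d" "\<And>k. k < n \<Longrightarrow> g k i = k"
    "\<And>j. j < d \<Longrightarrow> coord_rule n (\<lambda>k. g k j)"
    using line_param[OF assms(2,5,6) i] by metis
  have lt: "p i < n" "q i < n"
    using pq i by (auto simp: cube_def)
  have "f (r i) = r" if "r \<in> L" for r
    using that f(3) unfolding f(1) by auto
  moreover have "g (r i) = r" if "r \<in> M" for r
    using that g(3) unfolding g(1) by auto
  ultimately have at: "f (p i) = p" "f (q i) = q" "g (p i) = p" "g (q i) = q"
    using assms(3-6) by blast+
  have "f k = g k" if "k < n" for k
  proof (rule cube_eqI)
    fix j assume "j < d"
    then show "f k j = g k j"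
      using coord_rule_unique[OF f(4) g(4), of j j "p i" "q i"] lt i at that by simp
  qed (use f g that in auto)
  then show ?thesis unfolding f(1) g(1) by auto
qed

text \<open>Relative to a varying coordinate \<open>i\<close>, another varying coordinate is a copy
  or the reflection. This serves below to show that certain pairs of points are not
  collinear.\<close>

lemma line_coords:
  assumes "is_line n d L" "p \<in> L" "q \<in> L" "i < d" "j < d" "p i \<noteq> q i" "p j \<noteq> q j"
  shows "p j = p i \<and> q j = q i \<or> p j = n - 1 - p i \<and> q j = n - 1 - q i"
proof -
  obtain f where f: "L = f ` {..<n}" "\<And>k. k < n \<Longrightarrow> f k i = k"
    "\<And>j. j < d \<Longrightarrow> coord_rule n (\<lambda>k. f k j)"
    using line_param[OF assms(1-4,6)] by metis
  then obtain a b where ab: "a < n" "b < n" "p = f a" "q = f b"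
    using assms by auto
  show ?thesis
    using f(3)[OF \<open>j < d\<close>] assms(7) f(2) ab unfolding coord_rule_def by auto
qed

lemma is_lineI:
  assumes "n \<ge> 2" "i < d" "\<And>k. k < n \<Longrightarrow> f k \<in> cube n d" "\<And>k. k < n \<Longrightarrow> f k i = k"
    and "\<And>j. j < d \<Longrightarrow> coord_rule n (\<lambda>k. f k j)"
  shows "is_line n d (f ` {..<n})"
proof -
  have "inj_on f {..<n}"
    by (rule inj_onI) (metis assms(4) lessThan_iff)
  moreover have "strict_mono_on {..<n} (\<lambda>k. f k j) \<or> strict_antimono_on {..<n} (\<lambda>k. f k j) \<or>
      (\<exists>c. \<forall>k<n. f k j = c)" if "j < d" for j
    using assms(5)[OF that] unfolding coord_rule_def monotone_on_def by auto
  \<comment> \<open>This is where \<open>n \<ge> 2\<close> enters: the points with parameters 0 and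
    1 differ in coordinate \<open>i\<close>.\<close>
  moreover have "i \<in> nonconst_coords d (f ` {..<n})"
  proof -
    have "f 0 i \<noteq> f 1 i" using assms by simp
    moreover have "f 0 \<in> f ` {..<n}" "f 1 \<in> f ` {..<n}" using assms(1) by auto
    ultimately show ?thesis using assms(2) unfolding nonconst_coords_def by blast
  qed
  ultimately show ?thesis
    using assms(3) unfolding is_line_def by blast
qed

section \<open>Axis-parallel lines, diagonals and edges\<close>

lemma cube_upd: "p \<in> cube n d \<Longrightarrow> i < d \<Longrightarrow> k < n \<Longrightarrow> p(i := k) \<in> cube n d"
  unfolding cube_def by (auto simp: PiE_iff extensional_def)

lemma corner_upd:
  "p \<in> corners n d \<Longrightarrow> i < d \<Longrightarrow> k < n \<Longrightarrow> k \<in> {0, n - 1} \<Longrightarrow> p(i := k) \<in> corners n d"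
  by (auto simp: corners_def cube_upd)

definition axis_line :: "nat \<Rightarrow> (nat \<Rightarrow> nat) \<Rightarrow> nat \<Rightarrow> (nat \<Rightarrow> nat) set" where
  "axis_line n p i = (\<lambda>k. p(i := k)) ` {..<n}"

lemma axis_lineI: "k < n \<Longrightarrow> p(i := k) \<in> axis_line n p i"
  by (simp add: axis_line_def)

lemma mem_axis_line:
  assumes "p \<in> cube n d" "i < d"
  shows "p \<in> axis_line n p i"
proof -
  have "p i < n" using assms by (auto simp: cube_def)
  then show ?thesis using axis_lineI[of "p i" n p i] by simp
qed

lemma is_line_axis_line:
  assumes "n \<ge> 2" "p \<in> cube n d" "i < d"
  shows "is_line n d (axis_line n p i)"
  unfolding axis_line_def
  by (rule is_lineI[where i = i]) (use assms in \<open>auto simp: cube_upd coord_rule_def\<close>)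

lemma is_line_diagonal:
  assumes "n \<ge> 2" "p \<in> cube n d" "i < d" "j < d"
  shows "is_line n d ((\<lambda>k. p(i := k, j := k)) ` {..<n})"
  by (rule is_lineI[where i = i]) (use assms in \<open>auto simp: cube_upd coord_rule_def\<close>)

text \<open>The two corners on the edge differ in its only non-constant coordinate \<open>i\<close>
  and nowhere else. Both therefore lie on one axis line as well, and two common points make the
  lines equal.\<close>

lemma is_edge_axis_line:
  assumes "n \<ge> 2" "is_edge n d e"
  obtains c i where "c \<in> corners n d" "i < d" "e = axis_line n c i"
proof -
  obtain a b where ab: "a \<in> corners n d" "b \<in> corners n d" "a \<noteq> b" "a \<in> e" "b \<in> e"
    and e: "is_line n d e" "line_dim d e = 1"
    using assms(2) by (auto simp: is_edge_def)
  obtain i where i: "nonconst_coords d e = {i}"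
    using e(2) unfolding line_dim_def by (auto simp: card_1_singleton_iff)
  then have "i < d" by (auto simp: nonconst_coords_def)
  have cube: "a \<in> cube n d" "b \<in> cube n d" using ab by (auto simp: corners_def)
  have "b = a(i := b i)"
  proof (rule cube_eqI[of _ n d])
    show "a(i := b i) \<in> cube n d"
      using cube \<open>i < d\<close> by (intro cube_upd) (auto simp: cube_def)
    fix j assume "j < d"
    show "b j = (a(i := b i)) j"
    proof (cases "j = i")
      case False
      then have "j \<notin> nonconst_coords d e" using i by simp
      then show ?thesis using False ab \<open>j < d\<close> unfolding nonconst_coords_def by auto
    qed simp
  qed (use cube in auto)
  moreover have "b i < n" using cube \<open>i < d\<close> by (auto simp: cube_def)
  ultimately have "b \<in> axis_line n a i" by (metis axis_lineI)
  then have "e = axis_line n a i"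
    using line_unique[OF e(1) is_line_axis_line[OF assms(1) cube(1) \<open>i < d\<close>] ab(4,5)]
      mem_axis_line[OF cube(1) \<open>i < d\<close>] ab(3) by blast
  then show ?thesis using that ab \<open>i < d\<close> by blast
qed

section \<open>Automorphisms fixing all corners\<close>

locale corner_fixing_automorphism =
  fixes n d :: nat and T :: "(nat \<Rightarrow> nat) \<Rightarrow> (nat \<Rightarrow> nat)"
  assumes n_ge: "n \<ge> 2"
    and automorphism: "T \<in> line_automorphisms n d"
    and fix_corner: "p \<in> corners n d \<Longrightarrow> T p = p"
begin

text \<open>An edge is named by its direction and a corner on it; since \<open>c i\<close> is
  overwritten, both of its corners name the same edge.\<close>

definition edge_fixed :: "nat \<Rightarrow> (nat \<Rightarrow> nat) \<Rightarrow> bool" where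
  "edge_fixed i c \<longleftrightarrow> (\<forall>x<n. T (c(i := x)) = c(i := x))"

lemma inj_T: "inj T"
  using automorphism by (auto simp: line_automorphisms_def intro: permutes_inj)

lemma is_line_image: "is_line n d L \<Longrightarrow> is_line n d (T ` L)"
  using automorphism by (auto simp: line_automorphisms_def)

lemma line_invariant:
  assumes "is_line n d L" "p \<in> L" "q \<in> L" "p \<noteq> q" "T p = p" "T q = q" "r \<in> L"
  shows "T r \<in> L"
proof -
  have "p \<in> T ` L" "q \<in> T ` L"
    using assms by (metis image_eqI)+
  then have "T ` L = L"
    using line_unique[OF is_line_image[OF assms(1)] assms(1)] assms by blast
  then show ?thesis using assms by blast
qed

lemma axis_line_invariant:
  assumes "p \<in> cube n d" "i < d" "k < n" "T (p(i := 0)) = p(i := 0)"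
    and "T (p(i := n - 1)) = p(i := n - 1)"
  obtains k' where "k' < n" "T (p(i := k)) = p(i := k')"
proof -
  have "p(i := 0) \<noteq> p(i := n - 1)"
    using n_ge by (simp add: fun_eq_iff)
  then have "T (p(i := k)) \<in> axis_line n p i"
    using assms n_ge
    by (intro line_invariant[of _ "p(i := 0)" "p(i := n - 1)"])
      (auto intro: axis_lineI is_line_axis_line)
  then show ?thesis using that by (auto simp: axis_line_def)
qed

section \<open>Propagation of a pointwise fixed edge\<close>

lemma edge_invariant:
  assumes "c \<in> corners n d" "i < d" "k < n"
  obtains k' where "k' < n" "T (c(i := k)) = c(i := k')"
proof (rule axis_line_invariant[of c i k])
  show "T (c(i := 0)) = c(i := 0)" "T (c(i := n - 1)) = c(i := n - 1)"
    using assms n_ge by (auto intro!: fix_corner corner_upd)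
qed (use assms that in \<open>auto simp: corners_def\<close>)

text \<open>Let the opposite point move from \<open>x\<close> to \<open>x'\<close> along its edge.
  The image of the line joining it to the fixed point \<open>c(i := x)\<close> is again a line, and
  collinearity with \<open>x' \<noteq> x\<close> would force \<open>x\<close> to be 0 or
  \<open>n - 1\<close>.\<close>

lemma edge_fixed_opposite:
  assumes "edge_fixed i c" "c \<in> corners n d" "i < d" "j < d" "i \<noteq> j"
  shows "edge_fixed i (c(j := n - 1 - c j))"
  unfolding edge_fixed_def
proof (intro allI impI)
  fix x assume x: "x < n"
  define c' where "c' = c(j := n - 1 - c j)"
  have cj: "c j \<in> {0, n - 1}" "c j < n"
    using assms n_ge by (auto simp: corners_def)
  have c': "c' \<in> corners n d"
    unfolding c'_def using assms(2,4) cj n_ge by (intro corner_upd) auto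
  show "T (c'(i := x)) = c'(i := x)"
  proof (cases "x \<in> {0, n - 1}")
    case True
    then show ?thesis using c' assms x by (intro fix_corner corner_upd)
  next
    case False
    obtain x' where x': "x' < n" "T (c'(i := x)) = c'(i := x')"
      using edge_invariant[OF c' \<open>i < d\<close> x] .
    let ?p = "c(i := x)"
    let ?L = "axis_line n ?p j"
    have p: "?p \<in> cube n d"
      using assms x by (intro cube_upd) (auto simp: corners_def)
    have line: "is_line n d (T ` ?L)"
      using n_ge p assms by (intro is_line_image is_line_axis_line)
    have mem1: "?p \<in> T ` ?L"
      using mem_axis_line[OF p \<open>j < d\<close>] assms(1) x unfolding edge_fixed_def
      by (metis image_eqI)
    have "c'(i := x) \<in> ?L"
      unfolding c'_def using axis_lineI[of "n - 1 - c j" n ?p j] n_ge \<open>i \<noteq> j\<close>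
      by (simp add: fun_upd_twist)
    then have mem2: "c'(i := x') \<in> T ` ?L"
      using x'(2) by (metis image_eqI)
    have "x' = x"
    proof (rule ccontr)
      assume "x' \<noteq> x"
      \<comment> \<open>The \<open>j\<close>-th coordinates are \<open>c j\<close> and its
        reflection, the two ends of the range, which differ because
        \<open>n \<ge> 2\<close>.\<close>
      then have "?p i \<noteq> (c'(i := x')) i" "?p j \<noteq> (c'(i := x')) j"
        using cj n_ge \<open>i \<noteq> j\<close> by (auto simp: c'_def)
      from line_coords[OF line mem1 mem2 \<open>i < d\<close> \<open>j < d\<close> this]
      have "c j = x \<or> c j = n - 1 - x" using \<open>i \<noteq> j\<close> by auto
      then show False using cj False x by auto
    qed
    then show ?thesis using x' by simp
  qed
qed

text \<open>The diagonal point \<open>?r\<close> of the face is fixed, being the intersection of the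
  diagonal with the line joining the points at position \<open>x\<close> of the given edge and its
  opposite. It then pins down the point at position \<open>x\<close> of the perpendicular edge,
  again by collinearity.\<close>

lemma edge_fixed_perpendicular:
  assumes "edge_fixed i c" "c \<in> corners n d" "i < d" "j < d" "i \<noteq> j"
  shows "edge_fixed j c"
  unfolding edge_fixed_def
proof (intro allI impI)
  fix x assume x: "x < n"
  show "T (c(j := x)) = c(j := x)"
  proof (cases "x \<in> {0, n - 1}")
    case True
    then show ?thesis using assms x by (intro fix_corner corner_upd)
  next
    case False
    have cube: "c \<in> cube n d" and ci: "c i \<in> {0, n - 1}" "c j \<in> {0, n - 1}"
      using assms by (auto simp: corners_def)
    let ?r = "c(i := x, j := x)"
    let ?D = "(\<lambda>k. c(i := k, j := k)) ` {..<n}"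
    have diag: "T ?r \<in> ?D"
    proof (rule line_invariant[where p = "c(i := 0, j := 0)" and q = "c(i := n - 1, j := n - 1)"])
      show "T (c(i := 0, j := 0)) = c(i := 0, j := 0)"
        "T (c(i := n - 1, j := n - 1)) = c(i := n - 1, j := n - 1)"
        using assms n_ge by (auto intro!: fix_corner corner_upd)
      show "c(i := 0, j := 0) \<noteq> c(i := n - 1, j := n - 1)"
        using n_ge by (auto simp: fun_eq_iff intro: exI[of _ j])
      show "is_line n d ?D"
        using n_ge cube assms by (intro is_line_diagonal)
    qed (use x n_ge in auto)
    have near: "T (c(i := x)) = c(i := x)"
      using assms(1) x by (simp add: edge_fixed_def)
    have far: "T (c(i := x, j := n - 1 - c j)) = c(i := x, j := n - 1 - c j)"
      using edge_fixed_opposite[OF assms] x \<open>i \<noteq> j\<close>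
      by (simp add: edge_fixed_def fun_upd_twist)
    have near': "T (c(i := x, j := c j)) = c(i := x, j := c j)"
      using near \<open>i \<noteq> j\<close> by (simp add: fun_upd_idem)
    \<comment> \<open>As \<open>c j\<close> is 0 or \<open>n - 1\<close>, the near and far points
      are these two, in one order or the other.\<close>
    have ends: "T (c(i := x, j := 0)) = c(i := x, j := 0)"
      "T (c(i := x, j := n - 1)) = c(i := x, j := n - 1)"
      using ci(2) near' far by auto
    \<comment> \<open>The image of \<open>?r\<close> keeps its \<open>i\<close>-th coordinate
      \<open>x\<close>; lying on the diagonal, it then has \<open>j\<close>-th coordinate
      \<open>x\<close> too.\<close>
    obtain y where y: "T ?r = c(i := x, j := y)"
      using axis_line_invariant[of "c(i := x)" j x, OF _ \<open>j < d\<close> x ends] cube assms x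
      by (metis cube_upd)
    have "T ?r = ?r"
    proof -
      obtain k where "T ?r = c(i := k, j := k)" using diag by auto
      then have "k = x \<and> T ?r = c(i := k, j := k)"
        using y \<open>i \<noteq> j\<close> by (metis fun_upd_apply)
      then show ?thesis by simp
    qed
    obtain x' where x': "x' < n" "T (c(j := x)) = c(j := x')"
      using edge_invariant[OF assms(2) \<open>j < d\<close> x] .
    \<comment> \<open>Corners are fixed and \<open>T\<close> is injective, so no other point is sent
      to a corner.\<close>
    have interior: "x' \<notin> {0, n - 1}"
    proof
      assume "x' \<in> {0, n - 1}"
      then have "T (c(j := x')) = T (c(j := x))"
        using x' assms by (simp only: fix_corner[OF corner_upd])
      then have "c(j := x') = c(j := x)" using inj_T by (simp add: inj_eq)
      then have "x' = x" by (metis fun_upd_same)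
      then show False using False \<open>x' \<in> {0, n - 1}\<close> by simp
    qed
    let ?L = "axis_line n (c(j := x)) i"
    have cjx: "c(j := x) \<in> cube n d" using cube assms x by (intro cube_upd)
    have line: "is_line n d (T ` ?L)"
      using n_ge cjx assms by (intro is_line_image is_line_axis_line)
    have mem1: "?r \<in> T ` ?L"
      using axis_lineI[OF x, of "c(j := x)" i] \<open>i \<noteq> j\<close> \<open>T ?r = ?r\<close>
      by (metis fun_upd_twist image_eqI)
    have mem2: "c(j := x') \<in> T ` ?L"
      using mem_axis_line[OF cjx \<open>i < d\<close>] x'(2) by (metis image_eqI)
    have "x' = x"
    proof (rule ccontr)
      assume "x' \<noteq> x"
      then have "?r i \<noteq> (c(j := x')) i" "?r j \<noteq> (c(j := x')) j"
        using ci False \<open>i \<noteq> j\<close> by auto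
      \<comment> \<open>The relation is read off at the second point, whose \<open>i\<close>-th
        coordinate \<open>c i\<close> is an end; this would make \<open>x'\<close> an end as
        well.\<close>
      from line_coords[OF line mem1 mem2 \<open>i < d\<close> \<open>j < d\<close> this]
      have "x' = c i \<or> x' = n - 1 - c i" using \<open>i \<noteq> j\<close> by auto
      then show False using ci interior by auto
    qed
    then show ?thesis using x' by simp
  qed
qed

text \<open>The coordinates of \<open>c\<close> are replaced by those of \<open>c'\<close> one at a
  time. Each replacement leaves the edge unchanged or passes to the opposite edge of a face.\<close>

lemma edge_fixed_parallel:
  assumes "edge_fixed i c" "c \<in> corners n d" "c' \<in> corners n d" "i < d"
  shows "edge_fixed i c'"
proof -
  have "edge_fixed i (\<lambda>j. if j \<in> J then c' j else c j) \<and>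
      (\<lambda>j. if j \<in> J then c' j else c j) \<in> corners n d"
    if "finite J" "J \<subseteq> {..<d}" for J
    using that
  proof (induction J rule: finite_induct)
    case empty
    then show ?case using assms by simp
  next
    case (insert j J)
    let ?b = "\<lambda>j. if j \<in> J then c' j else c j"
    have b: "edge_fixed i ?b" "?b \<in> corners n d" using insert by auto
    have j: "j < d" using insert by simp
    have vals: "c' j \<in> {0, n - 1}" "c j \<in> {0, n - 1}" "c' j < n"
      using assms j n_ge by (auto simp: corners_def)
    have eq: "(\<lambda>k. if k \<in> insert j J then c' k else c k) = ?b(j := c' j)"
      by auto
    have "?b(j := c' j) \<in> corners n d"
      using b j vals by (intro corner_upd)
    moreover have "edge_fixed i (?b(j := c' j))"
    proof (cases "i = j")
      case True
      then show ?thesis using b by (simp add: edge_fixed_def)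
    next
      case False
      show ?thesis
      proof (cases "c' j = ?b j")
        case True
        then have "?b(j := c' j) = ?b" by (simp only: fun_upd_idem)
        then show ?thesis using b by simp
      next
        case ne: False
        then have "c' j = n - 1 - ?b j" using vals insert.hyps by auto
        then show ?thesis
          using edge_fixed_opposite[OF b \<open>i < d\<close> j False] by simp
      qed
    qed
    ultimately show ?case unfolding eq by simp
  qed
  from this[of "{..<d}"] have fixed: "edge_fixed i (\<lambda>j. if j < d then c' j else c j)"
    by simp
  \<comment> \<open>Beyond \<open>d\<close> both corners take the value \<open>undefined\<close>, by
    extensionality.\<close>
  have "(\<lambda>j. if j < d then c' j else c j) = c'"
    using assms by (auto simp: corners_def cube_def PiE_iff extensional_def)
  with fixed show ?thesis by simp
qed

lemma all_edges_fixed: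
  assumes "edge_fixed i c" "c \<in> corners n d" "i < d" "c' \<in> corners n d" "j < d"
  shows "edge_fixed j c'"
proof -
  have "edge_fixed i c'" using edge_fixed_parallel assms by blast
  then show ?thesis using edge_fixed_perpendicular assms by (cases "i = j") auto
qed

section \<open>Induction from the edges to all points\<close>

lemma all_points_fixed:
  assumes edges: "\<And>i c. i < d \<Longrightarrow> c \<in> corners n d \<Longrightarrow> edge_fixed i c"
    and "p \<in> cube n d"
  shows "T p = p"
  using assms(2)
proof (induction "card {i. i < d \<and> p i \<notin> {0, n - 1}}" arbitrary: p rule: less_induct)
  case (less p)
  let ?S = "\<lambda>p. {i. i < d \<and> p i \<notin> {0, n - 1}}"
  \<comment> \<open>Moving an interior coordinate to 0 or \<open>n - 1\<close> lowers the induction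
    measure. So both ends of the axis line through \<open>p\<close> are fixed and the line is
    preserved.\<close>
  have axis: "\<exists>k<n. T p = p(i := k)" if "i \<in> ?S p" for i
  proof -
    have i: "i < d" using that by simp
    have "T (p(i := k)) = p(i := k)" if "k \<in> {0, n - 1}" for k
    proof (rule less.hyps)
      have "?S (p(i := k)) \<subset> ?S p" using that \<open>i \<in> ?S p\<close> by auto
      then show "card (?S (p(i := k))) < card (?S p)"
        by (intro psubset_card_mono) auto
      show "p(i := k) \<in> cube n d"
        using less.prems i that n_ge by (intro cube_upd) auto
    qed
    moreover have "p i < n" using less.prems i by (auto simp: cube_def)
    ultimately obtain k where "k < n" "T (p(i := p i)) = p(i := k)"
      using axis_line_invariant[OF less.prems i, of "p i"] by blast
    then show ?thesis by auto
  qed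
  consider "?S p = {}" | i where "?S p = {i}" | i j where "i \<in> ?S p" "j \<in> ?S p" "i \<noteq> j"
    by blast
  then show ?case
  proof cases
    case 1
    then have "p \<in> corners n d" using less.prems by (auto simp: corners_def)
    then show ?thesis by (rule fix_corner)
  next
    \<comment> \<open>A single interior coordinate yields only one invariant line, so here the
      hypothesis on edges is used: \<open>p\<close> lies on the edge at the corner
      \<open>p(i := 0)\<close>.\<close>
    case 2
    then have i: "i < d" by auto
    have others: "p j \<in> {0, n - 1}" if "j < d" "j \<noteq> i" for j
      using 2 that by blast
    have "p(i := 0) \<in> corners n d"
      using others less.prems i n_ge unfolding corners_def by (auto simp: cube_upd)
    then have "edge_fixed i (p(i := 0))" using edges i by blast
    moreover have "p i < n" using less.prems i by (auto simp: cube_def)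
    ultimately show ?thesis by (auto simp: edge_fixed_def)
  next
    case 3
    \<comment> \<open>The image differs from \<open>p\<close> at most in coordinate
      \<open>i\<close>, and also at most in coordinate \<open>j\<close>, hence not at all.\<close>
    obtain k l where "T p = p(i := k)" "T p = p(j := l)"
      using axis[OF 3(1)] axis[OF 3(2)] by blast
    then have "k = p i" using 3(3) by (metis fun_upd_apply)
    with \<open>T p = p(i := k)\<close> show ?thesis by simp
  qed
qed

end

theorem theorem6:
  fixes n d :: nat
    and T :: "(nat \<Rightarrow> nat) \<Rightarrow> (nat \<Rightarrow> nat)"
    and e :: "(nat \<Rightarrow> nat) set"
  assumes "n \<ge> 3" and "d \<ge> 2"
    and "T \<in> line_automorphisms n d"
    and "\<forall>p \<in> corners n d. T p = p"
    and "is_edge n d e"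
    and "\<forall>p \<in> e. T p = p"
  shows "T = id"
proof -
  interpret corner_fixing_automorphism n d T
    using assms by unfold_locales auto
  obtain c i where e: "c \<in> corners n d" "i < d" "e = axis_line n c i"
    using is_edge_axis_line[OF n_ge assms(5)] .
  then have "edge_fixed i c"
    using assms(6) axis_lineI by (auto simp: edge_fixed_def)
  then have "edge_fixed j c'" if "j < d" "c' \<in> corners n d" for j c'
    using all_edges_fixed e that by blast
  then have "T p = p" if "p \<in> cube n d" for p
    using all_points_fixed that by blast
  moreover have "T permutes cube n d"
    using assms(3) by (simp add: line_automorphisms_def)
  \<comment> \<open>Outside the cube \<open>T\<close> is the identity by the definition of
    \<open>permutes\<close>.\<close>
  ultimately show ?thesis
    by (auto simp: fun_eq_iff permutes_def)
qed

end
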